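(* Let $m\ge1$ be an integer. Then, as formal power series, \[\gamma_m(x)=\frac{2x}{1-\sqrt{1-4x}}\left(1+\sum_{n=1}^{\infty}\left(\prod_{k=1}^{m}\frac{n+m-k+1}{k}\right)\left(\prod_{k=m+2}^{n+m+1}\frac{n+m+k+1}{k}\right)x^n\right).\]
   Context: A path is a finite sequence of points of $\mathbb{Z}^2$ in which each step is $(1,0)$ or $(0,1)$. For integers $0\le m\le n$, $\mathcal{C}_{n,m}$ denotes the number of paths from $(0,-2m)$ to $(n-m,n-m)$ not crossing the line $y=x$, i.e. all of whose points $(p,q)$ satisfy $q\le p$. For $m\ge0$, $\gamma_m(x)=\sum_{n\ge0}\mathcal{C}_{n+m,m}x^n$. Here $\sqrt{1-4x}$ is the formal power series with constant term $1$ whose square is $1-4x$, and $\frac{2x}{1-\sqrt{1-4x}}$ denotes the multiplicative inverse of the formal power series $\frac{1-\sqrt{1-4x}}{2x}$ (which has constant term $1$). *)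

theory Defs
  imports Complex_Main "HOL-Computational_Algebra.Formal_Power_Series"
begin

definition unit_step :: "int \<times> int \<Rightarrow> int \<times> int \<Rightarrow> bool" where
  "unit_step u v \<longleftrightarrow>
     v = (fst u + 1, snd u) \<or> v = (fst u, snd u + 1)"

definition lattice_path :: "(int \<times> int) list \<Rightarrow> bool" where
  "lattice_path ps \<longleftrightarrow> ps \<noteq> [] \<and> successively unit_step ps"

definition paths_below_diag :: "int \<times> int \<Rightarrow> int \<times> int \<Rightarrow> (int \<times> int) list set" where
  "paths_below_diag a b =
     {ps. lattice_path ps \<and> hd ps = a \<and> last ps = b \<and> (\<forall>(p, q) \<in> set ps. q \<le> p)}"

text \<open>Meaningful for \<open>m \<le> n\<close>.\<close>
definition num_paths :: "nat \<Rightarrow> nat \<Rightarrow> nat" where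
  "num_paths n m =
     card (paths_below_diag (0, - 2 * int m) (int n - int m, int n - int m))"

definition gamma_series :: "nat \<Rightarrow> rat fps" where
  "gamma_series m = Abs_fps (\<lambda>n. of_nat (num_paths (n + m) m))"

definition sqrt_one_minus_4x :: "rat fps" where
  "sqrt_one_minus_4x = (THE s. fps_nth s 0 = 1 \<and> s ^ 2 = 1 - 4 * fps_X)"

text \<open>Division in \<^typ>\<open>rat fps\<close> by a series with zero constant term cancels the leading
  power of \<^const>\<open>fps_X\<close>; here it is exact, see \<open>two_X_times_half_quotient\<close> below.\<close>
definition half_quotient :: "rat fps" where
  "half_quotient = (1 - sqrt_one_minus_4x) / (2 * fps_X)"

text \<open>The set counted by \<^const>\<open>num_paths\<close> is finite, so \<^const>\<open>card\<close> is its genuine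
  cardinality.\<close>
lemma finite_paths_below_diag: "finite (paths_below_diag a b)"
proof -
  define lt :: "int \<times> int \<Rightarrow> int \<times> int \<Rightarrow> bool" where
    "lt = (\<lambda>u v. fst u \<le> fst v \<and> snd u \<le> snd v \<and> u \<noteq> v)"
  have tr: "transp lt"
    by (auto simp: lt_def intro!: transpI)
  have "set ps \<subseteq> {fst a..fst b} \<times> {snd a..snd b} \<and> distinct ps"
    if "ps \<in> paths_below_diag a b" for ps
  proof -
    from that have ne: "ps \<noteq> []" and su: "successively unit_step ps"
      and h: "hd ps = a" and l: "last ps = b"
      by (auto simp: paths_below_diag_def lattice_path_def)
    have "successively lt ps"
      by (rule successively_mono[OF su]) (auto simp: unit_step_def lt_def)
    then have so: "sorted_wrt lt ps"
      using successively_conv_sorted_wrt[OF tr] by blast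
    have "distinct ps"
      unfolding distinct_conv_nth
      by (metis so lt_def linorder_neqE_nat sorted_wrt_nth_less)
    moreover have "x = hd ps \<or> lt (hd ps) x" if "x \<in> set ps" for x
      using so ne that by (cases ps) auto
    moreover have "x = last ps \<or> lt x (last ps)" if "x \<in> set ps" for x
      using so ne that by (cases ps rule: rev_cases) (auto simp: sorted_wrt_append)
    ultimately show ?thesis
      unfolding h l lt_def by fastforce
  qed
  then have "paths_below_diag a b \<subseteq>
      {ps. set ps \<subseteq> {fst a..fst b} \<times> {snd a..snd b} \<and> distinct ps}"
    by blast
  then show ?thesis
    by (rule finite_subset) (intro finite_subset_distinct finite_cartesian_product; simp)
qed

lemma ex1_sqrt_one_minus_4x:
  "\<exists>!s :: rat fps. fps_nth s 0 = 1 \<and> s ^ 2 = 1 - 4 * fps_X"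
proof (rule ex_ex1I)
  let ?b = "1 - 4 * fps_X :: rat fps" and ?r = "\<lambda>_ _. 1 :: rat"
  have "fps_radical ?r (Suc 1) ?b ^ Suc 1 = ?b"
    by (subst power_radical[symmetric]) auto
  then show "\<exists>s :: rat fps. fps_nth s 0 = 1 \<and> s ^ 2 = ?b"
    by (intro exI[of _ "fps_radical ?r (Suc 1) ?b"]) (simp add: numeral_2_eq_2)
next
  fix s t :: "rat fps"
  assume s: "fps_nth s 0 = 1 \<and> s ^ 2 = 1 - 4 * fps_X"
    and t: "fps_nth t 0 = 1 \<and> t ^ 2 = 1 - 4 * fps_X"
  then have "s = t \<or> s = - t"
    by (simp add: power2_eq_iff[symmetric])
  moreover have "s \<noteq> - t"
  proof
    assume "s = - t"
    then have "fps_nth s 0 = - fps_nth t 0" by simp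
    with s t show False by simp
  qed
  ultimately show "s = t" by blast
qed

lemma sqrt_one_minus_4x:
  "fps_nth sqrt_one_minus_4x 0 = 1" "sqrt_one_minus_4x ^ 2 = 1 - 4 * fps_X"
  using theI'[OF ex1_sqrt_one_minus_4x] unfolding sqrt_one_minus_4x_def by blast+

lemma two_X_times_half_quotient:
  "2 * fps_X * half_quotient = 1 - sqrt_one_minus_4x"
proof -
  let ?f = "1 - sqrt_one_minus_4x"
  have "fps_X * fps_shift 1 ?f = ?f"
    by (rule fps_ext) (simp add: sqrt_one_minus_4x)
  moreover have "2 * (inverse 2 :: rat fps) = 1"
    by (rule inverse_mult_eq_1') simp
  ultimately have "2 * fps_X * (inverse 2 * fps_shift 1 ?f) = ?f"
    by (metis mult.assoc mult.commute mult.left_neutral)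
  then have "2 * fps_X dvd ?f" by (metis dvd_triv_left)
  then show ?thesis unfolding half_quotient_def by simp
qed

lemma half_quotient_nth_0: "fps_nth half_quotient 0 = 1"
proof -
  have "fps_nth (sqrt_one_minus_4x ^ 2) 1 = - 4"
    by (simp add: sqrt_one_minus_4x(2) fps_mult_nth numeral_fps_const)
  then have "fps_nth sqrt_one_minus_4x 1 = - 2"
    by (simp add: power2_eq_square fps_mult_nth sqrt_one_minus_4x(1))
  moreover have "fps_nth (fps_X * (2 * half_quotient)) 1 = - fps_nth sqrt_one_minus_4x 1"
    using two_X_times_half_quotient by (simp add: mult_ac)
  ultimately show ?thesis
    by (simp add: numeral_fps_const)
qed

end

theory Submission
  imports Defs
begin

text \<open>
  Write \<open>c\<close> for \<^const>\<open>half_quotient\<close>.  It satisfies \<open>c = 1 + x c\<^sup>2\<close>, so the coefficient \<open>b(k, n)\<close>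
  of \<open>x\<^sup>n\<close> in the \<open>k\<close>-th power of \<open>c\<close> obeys \<open>b(k + 1, n + 1) = b(k, n + 1) + b(k + 2, n)\<close>.  Splitting
  by the first step, the number of paths from \<open>(0, 1 - k)\<close> to \<open>(n, n)\<close> not crossing the diagonal
  obeys the same recurrence, so \<open>\<gamma>\<^sub>m\<close> is the power of \<open>c\<close> with exponent \<open>2m + 1\<close>.  The recurrence is
  solved by the ballot numbers \<open>k / (2n + k) \<cdot> (2n + k choose n)\<close>, and for \<open>k = 2m + 2\<close> these are
  the products in the theorem.
\<close>

text \<open>The recursion descends lexicographically in \<open>n\<close>, then \<open>k\<close>;
  \<open>ballot.induct\<close> serves the closed form, the powers of \<open>half_quotient\<close>
  and the path counts alike.\<close>

fun ballot :: "nat \<Rightarrow> nat \<Rightarrow> nat" where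
  "ballot 0 n = (if n = 0 then 1 else 0)"
| "ballot (Suc k) 0 = 1"
| "ballot (Suc k) (Suc n) = ballot k (Suc n) + ballot (Suc (Suc k)) n"

lemma ballot_closed_form: "(2 * n + k) * ballot k n = k * (2 * n + k choose n)"
proof (induction k n rule: ballot.induct)
  case (3 k n)
  define N where "N = 2 * n + k + 2"
  have IH: "N * ballot k (Suc n) = k * (N choose Suc n)"
    "N * ballot (Suc (Suc k)) n = (k + 2) * (N choose n)"
    using 3 by (simp_all add: N_def algebra_simps)
  have b: "Suc N * (N choose n) = Suc n * (Suc N choose Suc n)"
    by (simp only: Suc_times_binomial_eq mult.commute)
  \<comment> \<open>Pascal's rule times \<open>Suc N\<close>, minus \<open>b\<close>: both binomials
    of the recurrence become multiples of \<open>Suc N choose Suc n\<close>.\<close>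
  have b': "Suc N * (N choose Suc n) = (N - n) * (Suc N choose Suc n)"
  proof -
    have "Suc N * (N choose Suc n) + Suc n * (Suc N choose Suc n) =
        (N - n + Suc n) * (Suc N choose Suc n)"
      unfolding b[symmetric] by (simp add: N_def algebra_simps)
    then show ?thesis by (simp only: add_mult_distrib add_right_cancel)
  qed
  have "N * (Suc N * ballot (Suc k) (Suc n)) =
      Suc N * (N * ballot k (Suc n)) + Suc N * (N * ballot (Suc (Suc k)) n)"
    by (simp add: algebra_simps)
  also have "\<dots> = k * (Suc N * (N choose Suc n)) + (k + 2) * (Suc N * (N choose n))"
    by (simp only: IH mult.left_commute)
  also have "\<dots> = (k * (N - n) + (k + 2) * Suc n) * (Suc N choose Suc n)"
    by (simp only: b b' add_mult_distrib mult.assoc)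
  also have "k * (N - n) + (k + 2) * Suc n = N * Suc k"
    by (simp add: N_def algebra_simps)
  finally have "N * (Suc N * ballot (Suc k) (Suc n)) = N * (Suc k * (Suc N choose Suc n))"
    by (simp only: mult.assoc)
  moreover have "N \<noteq> 0" by (simp add: N_def)
  ultimately have "Suc N * ballot (Suc k) (Suc n) = Suc k * (Suc N choose Suc n)"
    by (metis mult_left_cancel)
  moreover have "2 * Suc n + Suc k = Suc N" by (simp add: N_def)
  ultimately show ?case by metis
qed auto

text \<open>Squaring \<open>1 - 2 * fps_X * half_quotient\<close>, which is the square root, leaves
  a multiple of \<open>4 * fps_X\<close> to cancel in an integral domain.\<close>

lemma half_quotient_eq: "half_quotient = 1 + fps_X * half_quotient ^ 2"
proof -
  let ?c = half_quotient
  have "1 - 4 * fps_X = (1 - 2 * fps_X * ?c) ^ 2"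
    using sqrt_one_minus_4x(2) by (simp add: two_X_times_half_quotient)
  moreover have "(1 - 2 * fps_X * ?c) ^ 2 - (1 - 4 * fps_X) = 4 * fps_X * (1 + fps_X * ?c ^ 2 - ?c)"
    by (simp add: power2_eq_square algebra_simps)
  ultimately have "4 * fps_X * (1 + fps_X * ?c ^ 2 - ?c) = 0"
    by simp
  moreover have "(4 :: rat fps) \<noteq> 0"
    by (simp add: numeral_fps_const)
  ultimately show ?thesis by simp
qed

lemma half_quotient_power_nth: "fps_nth (half_quotient ^ k) n = of_nat (ballot k n)"
proof (induction k n rule: ballot.induct)
  case (2 k)
  show ?case by (simp add: fps_nth_power_0 half_quotient_nth_0 fps_mult_nth)
next
  case (3 k n)
  have "half_quotient ^ Suc k = half_quotient ^ k * (1 + fps_X * half_quotient ^ 2)"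
    unfolding half_quotient_eq[symmetric] by (simp add: mult.commute)
  also have "\<dots> = half_quotient ^ k + fps_X * half_quotient ^ Suc (Suc k)"
    by (simp add: algebra_simps power2_eq_square)
  finally show ?case using 3 by (simp del: power_Suc)
qed auto

lemma paths_below_diag_mono:
  assumes "ps \<in> paths_below_diag a b"
  shows "fst a \<le> fst b \<and> snd a \<le> snd b"
proof -
  have "ps \<noteq> [] \<Longrightarrow> successively unit_step ps \<Longrightarrow>
      fst (hd ps) \<le> fst (last ps) \<and> snd (hd ps) \<le> snd (last ps)" for ps
    by (induction ps rule: induct_list012) (auto simp: unit_step_def)
  with assms show ?thesis by (auto simp: paths_below_diag_def lattice_path_def)
qed

lemma paths_below_diag_empty: "p < q \<Longrightarrow> paths_below_diag (p, q) b = {}"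
  by (fastforce simp: paths_below_diag_def lattice_path_def dest: hd_in_set)

text \<open>A path that has not reached its end has a second point, and \<open>q \<le> p\<close>
  allows prepending \<open>(p, q)\<close> again.\<close>

lemma paths_below_diag_step:
  assumes "q \<le> p" "(p, q) \<noteq> b"
  shows "paths_below_diag (p, q) b =
    Cons (p, q) ` (paths_below_diag (p, q + 1) b \<union> paths_below_diag (p + 1, q) b)"
proof (intro equalityI subsetI)
  fix ps assume ps: "ps \<in> paths_below_diag (p, q) b"
  then obtain r rs where "ps = (p, q) # r # rs"
    using assms(2) by (cases ps rule: remdups_adj.cases)
      (auto simp: paths_below_diag_def lattice_path_def)
  with ps show "ps \<in> Cons (p, q) ` (paths_below_diag (p, q + 1) b \<union> paths_below_diag (p + 1, q) b)"
    by (auto simp: paths_below_diag_def lattice_path_def unit_step_def)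
qed (use assms in \<open>auto simp: paths_below_diag_def lattice_path_def unit_step_def successively_Cons\<close>)

lemma card_paths_below_diag_step:
  assumes "q \<le> p" "(p, q) \<noteq> b"
  shows "card (paths_below_diag (p, q) b) =
    card (paths_below_diag (p, q + 1) b) + card (paths_below_diag (p + 1, q) b)"
proof -
  have "paths_below_diag (p, q + 1) b \<inter> paths_below_diag (p + 1, q) b = {}"
    by (auto simp: paths_below_diag_def)
  then show ?thesis
    by (simp add: paths_below_diag_step[OF assms] card_image card_Un_disjoint finite_paths_below_diag)
qed

lemma paths_below_diag_refl: "paths_below_diag (p, p) (p, p) = {[(p, p)]}"
proof -
  have "ps = [(p, p)]" if "ps \<in> paths_below_diag (p, p) (p, p)" for ps
  proof (cases ps rule: remdups_adj.cases)
    case (3 a r rs)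
    with that have "r # rs \<in> paths_below_diag r (p, p)" "unit_step (p, p) r"
      by (auto simp: paths_below_diag_def lattice_path_def)
    \<comment> \<open>After one step a coordinate exceeds \<open>p\<close>, and coordinates never
      decrease.\<close>
    then show ?thesis
      using paths_below_diag_mono by (fastforce simp: unit_step_def)
  qed (use that in \<open>auto simp: paths_below_diag_def lattice_path_def\<close>)
  then show ?thesis by (auto simp: paths_below_diag_def lattice_path_def)
qed

text \<open>For \<open>k = n = 0\<close> the left-hand side is 0: the start point \<open>(e, e + 1)\<close> lies above the diagonal.\<close>

lemma card_paths_below_diag:
  assumes "k > 0 \<or> n > 0"
  shows "card (paths_below_diag (e - int n, e - int n + 1 - int k) (e, e)) = ballot k n"
  using assms
proof (induction k n rule: ballot.induct)
  case (1 n)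
  then show ?case by (simp add: paths_below_diag_empty)
next
  case (2 k)
  show ?case
  proof (induction k)
    case 0
    show ?case by (simp add: paths_below_diag_refl)
  next
    case (Suc k)
    \<comment> \<open>In the column of the end point only upward steps are possible.\<close>
    have "paths_below_diag (e + 1, e - 1 - int k) (e, e) = {}"
      using paths_below_diag_mono by fastforce
    then show ?case
      using Suc card_paths_below_diag_step[of "e - 1 - int k" e "(e, e)"]
      by (simp add: algebra_simps)
  qed
next
  case (3 k n)
  \<comment> \<open>A step up lowers the first index of \<open>ballot\<close> by one; a step right
    raises it by one and lowers \<open>n\<close>.\<close>
  then show ?case
    using card_paths_below_diag_step[of "e - 1 - int n - int k" "e - 1 - int n" "(e, e)"]
    by (simp add: algebra_simps)
qed

lemma gamma_series_eq_power: "gamma_series m = half_quotient ^ (2 * m + 1)"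
proof (rule fps_ext)
  fix n
  show "fps_nth (gamma_series m) n = fps_nth (half_quotient ^ (2 * m + 1)) n"
    \<comment> \<open>With \<open>e = n\<close> and \<open>k = 2 * m + 1\<close> the start is
      \<open>(0, - 2 * m)\<close>.\<close>
    using card_paths_below_diag[of "2 * m + 1" n "int n"]
    unfolding half_quotient_power_nth by (simp add: gamma_series_def num_paths_def)
qed

lemma prod_shift_eq_fact:
  "(\<Prod>k=Suc a..a + n. of_nat (c + k)) = (fact (c + a + n) / fact (c + a) :: 'a :: field_char_0)"
  by (induction n) (simp_all add: add_ac mult_ac)

lemma ballot_eq_prod:
  "(\<Prod>k=1..m. (of_nat n + of_nat m - of_nat k + 1) / of_nat k) *
   (\<Prod>k=m+2..n+m+1. (of_nat n + of_nat m + of_nat k + 1) / of_nat k) =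
     (of_nat (ballot (2 * m + 2) n) :: 'a :: field_char_0)"
proof -
  have "(\<Prod>k=1..m. of_nat n + of_nat m - of_nat k + 1 :: 'a) =
      (\<Prod>k=Suc 0..0 + m. of_nat (n + k))"
    \<comment> \<open>Reversal turns the factors descending from \<open>n + m\<close> to
      \<open>n + 1\<close> into ascending ones.\<close>
    by (subst prod.atLeastAtMost_rev) (auto intro!: prod.cong simp: of_nat_diff)
  also have "\<dots> = fact (n + m) / fact n"
    unfolding prod_shift_eq_fact by simp
  finally have p: "(\<Prod>k=1..m. (of_nat n + of_nat m - of_nat k + 1) / of_nat k :: 'a) =
      fact (n + m) / (fact n * fact m)"
    by (simp add: prod_dividef fact_prod)
  have "(\<Prod>k=m+2..n+m+1. of_nat n + of_nat m + of_nat k + 1 :: 'a) =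
      (\<Prod>k=Suc (m + 1)..m + 1 + n. of_nat (n + m + 1 + k))"
    by (auto intro!: prod.cong simp: add_ac)
  also have "\<dots> = fact (2 * n + 2 * m + 2) / fact (n + 2 * m + 2)"
    unfolding prod_shift_eq_fact
    by (intro arg_cong2[where f = "(/)"] arg_cong[where f = fact]) simp_all
  finally have q: "(\<Prod>k=m+2..n+m+1. of_nat n + of_nat m + of_nat k + 1 :: 'a) =
      fact (2 * n + 2 * m + 2) / fact (n + 2 * m + 2)" .
  have r: "(\<Prod>k=m+2..n+m+1. of_nat k :: 'a) = fact (n + m + 1) / fact (m + 1)"
    using prod_shift_eq_fact[of 0 "m + 1" n, where 'a = 'a] by (simp add: add_ac)
  have ne: "of_nat (n + m + 1) \<noteq> (0 :: 'a)"
    by (simp only: of_nat_eq_0_iff)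
  have "2 * ((n + m + 1) * ballot (2 * m + 2) n) = 2 * ((m + 1) * (2 * n + 2 * m + 2 choose n))"
    using ballot_closed_form[of n "2 * m + 2"] by (simp add: algebra_simps)
  then have "(n + m + 1) * ballot (2 * m + 2) n = (m + 1) * (2 * n + 2 * m + 2 choose n)"
    by (metis mult_left_cancel zero_neq_numeral)
  from arg_cong[OF this, of "of_nat :: nat \<Rightarrow> 'a"]
  have "of_nat (n + m + 1) * of_nat (ballot (2 * m + 2) n) =
      (of_nat (m + 1) * (fact (2 * n + 2 * m + 2) / (fact n * fact (n + 2 * m + 2))) :: 'a)"
    by (simp only: of_nat_mult binomial_fact[of n "2 * n + 2 * m + 2", where 'a = 'a]) simp
  then have "of_nat (ballot (2 * m + 2) n) = (of_nat (m + 1) / of_nat (n + m + 1) *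
      (fact (2 * n + 2 * m + 2) / (fact n * fact (n + 2 * m + 2))) :: 'a)"
    using ne by (metis nonzero_mult_div_cancel_left times_divide_eq_left)
  also have "\<dots> = fact (n + m) / (fact n * fact m) *
      (fact (2 * n + 2 * m + 2) / fact (n + 2 * m + 2) / (fact (n + m + 1) / fact (m + 1)))"
  proof -
    have f: "fact (n + m + 1) = (of_nat (n + m + 1) * fact (n + m) :: 'a)"
      "fact (m + 1) = (of_nat (m + 1) * fact m :: 'a)" by simp_all
    \<comment> \<open>Here \<open>g\<close> and \<open>h\<close> stand for
      \<open>fact (n + m)\<close> and \<open>fact m\<close>, which cancel once \<open>f\<close>
      splits the larger factorials.\<close>
    have "a / b * (P / (x * Q)) = g / (x * h) * (P / Q / (b * g / (a * h)))"
      if "g \<noteq> 0" "h \<noteq> 0" for a b P Q x g h :: 'a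
      using that by (simp add: mult_ac)
    then show ?thesis
      unfolding f by (simp only: fact_nonzero not_False_eq_True)
  qed
  finally show ?thesis
    by (simp only: p) (simp only: prod_dividef q r)
qed

theorem theorem7p1:
  fixes m :: nat
  assumes "m \<ge> 1"
  shows "gamma_series m =
    inverse half_quotient *
      (1 + Abs_fps (\<lambda>n. if n = 0 then 0 else
         (\<Prod>k=1..m. (of_nat n + of_nat m - of_nat k + 1) / of_nat k) *
         (\<Prod>k=m+2..n+m+1. (of_nat n + of_nat m + of_nat k + 1) / of_nat k)))"
proof -
  have "1 + Abs_fps (\<lambda>n. if n = 0 then 0 else
         (\<Prod>k=1..m. (of_nat n + of_nat m - of_nat k + 1) / of_nat k) *
         (\<Prod>k=m+2..n+m+1. (of_nat n + of_nat m + of_nat k + 1) / of_nat k)) =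
      half_quotient ^ (2 * m + 2)" (is "?G = _")
  proof (rule fps_ext)
    fix n
    \<comment> \<open>At \<open>n = 0\<close> the summand is 0 and the separate 1 supplies
      \<open>ballot (2 * m + 2) 0\<close>.\<close>
    show "fps_nth ?G n = fps_nth (half_quotient ^ (2 * m + 2)) n"
      unfolding half_quotient_power_nth ballot_eq_prod by (cases n) simp_all
  qed
  also have "\<dots> = half_quotient * gamma_series m"
    by (simp add: gamma_series_eq_power)
  finally show ?thesis
    by (simp add: mult.assoc[symmetric] inverse_mult_eq_1 half_quotient_nth_0)
qed

end
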